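(* Let $A\in\mathbb{R}^{n\times n}$ be invertible, let $X_0=\alpha A^T$ with $0<\alpha<2/\|A\|_2^2$, and let $(X_k)_{k\ge0}$, $(F_k)_{k\ge 0}$, $(\alpha_k)_{k\ge 0}$, $(\beta_k)_{k\ge 0}$ be generated by the SSHP2 method. If $1\notin\sigma(F_k)$ for all $k\in\mathbb{N}_0$, and there exist a non-negative integer $l$ and a positive constant $m$ such that $\beta_k>m$ for all $k\ge l$, then the iterative process SSHP2 converges.
   Context: $\mathbb{N}_0=\{0,1,2,\dots\}$; $\|\cdot\|_2$ is the spectral norm, $\|\cdot\|_F$ the Frobenius norm, $\sigma(Q)$ the spectrum. SSHP2 method: for $k\in\mathbb{N}_0$ put $F_k=I-AX_k$ and $$D_k=\|I-F_k\|_F^2\,\|I-F_k^2\|_F^2-\big(\mathrm{tr}((I-F_k^2)(I-F_k))\big)^2 .$$ If $D_k\ne0$, set $$\alpha_k=\frac{\|I-F_k^2\|_F^2\,\mathrm{tr}(I-F_k)-\mathrm{tr}(I-F_k^2)\,\mathrm{tr}((I-F_k^2)(I-F_k))}{D_k},$$ $$\beta_k=\frac{\|I-F_k\|_F^2\,\mathrm{tr}(I-F_k^2)-\mathrm{tr}(I-F_k)\,\mathrm{tr}((I-F_k^2)(I-F_k))}{D_k};$$ if $D_k=0$, set $\alpha_k=0$, $\beta_k=1$. Then $$X_{k+1}=X_k\big((\alpha_k+\beta_k)I+\beta_kF_k\big),\quad\text{so that}\quad F_{k+1}=(1-\alpha_k-\beta_k)I+\alpha_kF_k+\beta_kF_k^2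 .$$ Since $X_0=\alpha A^T$, all $F_k$ are real symmetric. The method is run without a stopping criterion. "SSHP2 converges" means $\lim_{k\to\infty}F_k=0$, equivalently $X_k\to A^{-1}$. *)

theory Defs
  imports "HOL-Analysis.Analysis"
begin

text \<open>
  On \<open>real^'n^'n\<close> the constant \<open>1\<close> and the operations \<open>*\<close> and \<open>^\<close> are componentwise, so the
  identity matrix is \<open>mat 1\<close> and \<open>F\<^sup>2\<close> is written \<open>F ** F\<close>.  The library norm \<open>norm\<close> on this
  type is the Frobenius norm; the spectral norm of \<open>A\<close> is \<open>onorm ((*v) A)\<close>.
\<close>

text \<open>The spectrum of a real matrix is the set of its complex eigenvalues.\<close>

definition spectrum :: "real^'n^'n \<Rightarrow> complex set" where
  "spectrum Q = {z. \<exists>v :: complex^'n. v \<noteq> 0 \<and> (\<chi> i j. complex_of_real (Q $ i $ j)) *v v = z *s v}"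

definition SSHP2_D :: "real^'n^'n \<Rightarrow> real" where
  "SSHP2_D F = (norm (mat 1 - F))\<^sup>2 * (norm (mat 1 - F ** F))\<^sup>2
     - (trace ((mat 1 - F ** F) ** (mat 1 - F)))\<^sup>2"

definition SSHP2_\<alpha> :: "real^'n^'n \<Rightarrow> real" where
  "SSHP2_\<alpha> F = (if SSHP2_D F = 0 then 0 else
     ((norm (mat 1 - F ** F))\<^sup>2 * trace (mat 1 - F)
       - trace (mat 1 - F ** F) * trace ((mat 1 - F ** F) ** (mat 1 - F))) / SSHP2_D F)"

definition SSHP2_\<beta> :: "real^'n^'n \<Rightarrow> real" where
  "SSHP2_\<beta> F = (if SSHP2_D F = 0 then 1 else
     ((norm (mat 1 - F))\<^sup>2 * trace (mat 1 - F ** F)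
       - trace (mat 1 - F) * trace ((mat 1 - F ** F) ** (mat 1 - F))) / SSHP2_D F)"

primrec SSHP2_X :: "real^'n^'n \<Rightarrow> real^'n^'n \<Rightarrow> nat \<Rightarrow> real^'n^'n" where
  "SSHP2_X A X0 0 = X0"
| "SSHP2_X A X0 (Suc k) =
     (let X = SSHP2_X A X0 k; F = mat 1 - A ** X; a = SSHP2_\<alpha> F; b = SSHP2_\<beta> F
      in X ** ((a + b) *\<^sub>R mat 1 + b *\<^sub>R F))"

definition SSHP2_F :: "real^'n^'n \<Rightarrow> real^'n^'n \<Rightarrow> nat \<Rightarrow> real^'n^'n" where
  "SSHP2_F A X0 k = mat 1 - A ** SSHP2_X A X0 k"

definition SSHP2_converges :: "real^'n^'n \<Rightarrow> real^'n^'n \<Rightarrow> bool" where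
  "SSHP2_converges A X0 \<longleftrightarrow> (\<lambda>k. SSHP2_F A X0 k) \<longlonglongrightarrow> 0"

end

theory Submission
  imports Defs
begin

text \<open>
  All \<open>F\<^sub>k\<close> are polynomials in the symmetric matrix \<open>F\<^sub>0\<close>, so one orthogonal basis diagonalises them
  all and only the eigenvalues \<open>\<lambda>\<^sub>i\<close> evolve.  When \<open>D\<^sub>k \<noteq> 0\<close>, the pair \<open>(\<alpha>\<^sub>k, \<beta>\<^sub>k)\<close> solves the least
  squares problem for \<open>F\<^sub>k\<^sub>+\<^sub>1 = I - \<alpha> (I - F\<^sub>k) - \<beta> (I - F\<^sub>k\<^sup>2)\<close>, whence
  \<open>\<parallel>F\<^sub>k\<parallel>\<^sup>2 = \<parallel>F\<^sub>k\<^sub>+\<^sub>1\<parallel>\<^sup>2 + \<parallel>F\<^sub>k - F\<^sub>k\<^sub>+\<^sub>1\<parallel>\<^sup>2\<close>: the Frobenius norms decrease from \<open>\<parallel>F\<^sub>0\<parallel> < \<surd>n\<close> and the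
  steps tend to 0.  A step equals \<open>\<beta>\<^sub>k (1 - \<lambda>\<^sub>i) (\<lambda>\<^sub>i - r\<^sub>k)\<close> with \<open>r\<^sub>k = (1 - \<alpha>\<^sub>k - \<beta>\<^sub>k) / \<beta>\<^sub>k\<close>.
  As \<open>\<beta>\<^sub>k > m\<close>, these products without \<open>\<beta>\<^sub>k\<close> vanish in the limit; by orthogonality so does
  \<open>\<Sum>\<^sub>i \<lambda>\<^sub>i (1 - \<lambda>\<^sub>i)\<close>, hence \<open>r\<^sub>k (n - tr F\<^sub>k) \<rightarrow> 0\<close> and, the trace staying away from \<open>n\<close>, \<open>r\<^sub>k \<rightarrow> 0\<close>.
  So every \<open>\<lambda>\<^sub>i\<close> accumulates only at 0 and 1, and 1 is repelling because \<open>1 - \<lambda>\<^sub>i\<close> is multiplied by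
  \<open>1 + \<beta>\<^sub>k (\<lambda>\<^sub>i - r\<^sub>k) \<ge> 1 + m/2\<close> near 1 and never is 0.

  If \<open>D\<^sub>k = 0\<close> for some \<open>k\<close>, take the first one: equality in Cauchy-Schwarz and \<open>1 \<notin> \<sigma>(F\<^sub>k)\<close> force
  \<open>F\<^sub>k = s I\<close>, with \<open>\<bar>s\<bar> < 1\<close> by the norm bound, and from then on the iteration squares \<open>s\<close>.
\<close>

subsection \<open>Orthogonal diagonalisation of real symmetric matrices\<close>

text \<open>A maximiser \<open>v\<close> of the Rayleigh quotient on the compact unit sphere of
  \<open>S\<close> is an eigenvector: the part of \<open>f v\<close> orthogonal to \<open>v\<close>
  lies in \<open>S\<close>, and if it were non-zero, moving towards it would increase the
  quotient.\<close>

lemma selfadjoint_eigenvector_in_subspace: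
  fixes f :: "'a::euclidean_space \<Rightarrow> 'a"
  assumes "linear f" and sa: "\<And>x y. f x \<bullet> y = x \<bullet> f y"
    and S: "subspace S" "S \<noteq> {0}" "f ` S \<subseteq> S"
  obtains v c where "v \<in> S" "norm v = 1" "f v = c *\<^sub>R v"
proof -
  interpret linear f by fact
  have "compact (sphere 0 1 \<inter> S)"
    by (simp add: compact_Int_closed closed_subspace S(1))
  moreover obtain u where "u \<in> S" "u \<noteq> 0"
    using S subspace_0 by blast
  then have "u /\<^sub>R norm u \<in> sphere 0 1 \<inter> S"
    using S(1) by (simp add: subspace_scale)
  moreover have "continuous_on (sphere 0 1 \<inter> S) (\<lambda>x. x \<bullet> f x)"
    by (intro continuous_intros linear_continuous_on \<open>linear f\<close> linear_conv_bounded_linear[THEN iffD1])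
  ultimately have "\<exists>v\<in>sphere 0 1 \<inter> S. \<forall>x\<in>sphere 0 1 \<inter> S. x \<bullet> f x \<le> v \<bullet> f v"
    by (intro continuous_attains_sup) blast+
  then obtain v where v: "v \<in> S" "norm v = 1"
    and max: "\<And>x. x \<in> sphere 0 1 \<inter> S \<Longrightarrow> x \<bullet> f x \<le> v \<bullet> f v"
    unfolding Bex_def Ball_def Int_iff mem_sphere_0 by blast
  define c where "c = v \<bullet> f v"
  have quot: "x \<bullet> f x \<le> c * (x \<bullet> x)" if "x \<in> S" for x
  proof (cases "x = 0")
    case False
    have "(x /\<^sub>R norm x) \<bullet> f (x /\<^sub>R norm x) \<le> c"
      unfolding c_def using that False S(1) by (intro max) (simp add: subspace_scale)
    then show ?thesis
      using False by (simp add: scale field_simps dot_square_norm power2_eq_square)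
  qed (simp add: zero)
  define w where "w = f v - c *\<^sub>R v"
  have wS: "w \<in> S"
    using S v(1) unfolding w_def by (auto intro: subspace_diff subspace_scale)
  define K where "K = c * (w \<bullet> w) - w \<bullet> f w"
  have fv: "f v = w + c *\<^sub>R v" by (simp add: w_def)
  have vw: "v \<bullet> w = 0"
    using v(2) by (simp add: w_def inner_diff_right c_def norm_eq_1)
  \<comment> \<open>first-order optimality: perturb the maximiser \<open>v\<close> of the Rayleigh quotient to \<open>v + t w\<close>\<close>
  have ineq: "2 * t * (w \<bullet> w) \<le> t\<^sup>2 * K" for t
  proof -
    have "(v + t *\<^sub>R w) \<bullet> f (v + t *\<^sub>R w) \<le> c * ((v + t *\<^sub>R w) \<bullet> (v + t *\<^sub>R w))"
      using S(1) v(1) wS by (intro quot) (auto intro: subspace_add subspace_scale)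
    moreover have "v \<bullet> f w = w \<bullet> w"
      using sa[of v w] vw by (simp add: fv inner_add_left)
    moreover have "v \<bullet> v = 1" using v(2) by (simp add: norm_eq_1)
    ultimately show ?thesis
      using vw by (simp add: add scale fv K_def algebra_simps inner_commute power2_eq_square)
  qed
  have "w \<bullet> w = 0"
  proof (rule ccontr)
    define a where "a = w \<bullet> w"
    assume "w \<bullet> w \<noteq> 0"
    then have a: "a > 0" by (simp add: a_def)
    \<comment> \<open>Small enough for the linear term to win:
      \<open>q * (\<bar>K\<bar> + 1) = a\<close> bounds the quadratic term by \<open>q * a\<close>,
      half of the linear one.\<close>
    define q where "q = a / (\<bar>K\<bar> + 1)"
    have "2 * q * a \<le> q\<^sup>2 * K"
      using ineq a_def by blast
    also have "\<dots> \<le> q\<^sup>2 * (\<bar>K\<bar> + 1)"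
      by (intro mult_left_mono) auto
    also have "\<dots> = q * a"
      by (simp add: q_def power2_eq_square)
    finally have "q * a \<le> 0" by linarith
    moreover have "q * a > 0" using a by (simp add: q_def)
    ultimately show False by simp
  qed
  then have "f v = c *\<^sub>R v" by (simp add: fv)
  with v that show thesis by blast
qed

text \<open>Split off one eigenvector \<open>v\<close>; self-adjointness keeps its orthogonal
  complement \<open>T\<close> in \<open>S\<close> invariant, so induction on the dimension applies
  to \<open>T\<close>.\<close>

lemma selfadjoint_orthonormal_eigenbasis:
  fixes f :: "'a::euclidean_space \<Rightarrow> 'a"
  assumes "linear f" and sa: "\<And>x y. f x \<bullet> y = x \<bullet> f y"
    and "subspace S" "f ` S \<subseteq> S"
  shows "\<exists>B \<subseteq> S. pairwise orthogonal B \<and> (\<forall>b\<in>B. norm b = 1 \<and> (\<exists>c. f b = c *\<^sub>R b)) \<and> span B = S"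
  using assms(3,4)
proof (induction "dim S" arbitrary: S rule: less_induct)
  case less
  show ?case
  proof (cases "S = {0}")
    case True
    then show ?thesis by (intro exI[of _ "{}"]) auto
  next
    case False
    obtain v c where v: "v \<in> S" "norm v = 1" "f v = c *\<^sub>R v"
      using selfadjoint_eigenvector_in_subspace[OF assms(1) sa less.prems(1) False less.prems(2)] by blast
    have vv: "v \<bullet> v = 1" using v(2) by (simp add: norm_eq_1)
    define T where "T = S \<inter> {y. orthogonal v y}"
    have T: "subspace T"
      unfolding T_def using less.prems(1) subspace_orthogonal_to_vector[of v] by (rule subspace_inter)
    have fT: "f ` T \<subseteq> T"
      using less.prems(2) by (auto simp: T_def orthogonal_def sa[symmetric] v(3))
    have "v \<notin> T" using vv by (auto simp: T_def orthogonal_def)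
    then have "T \<subset> S" using v(1) by (auto simp: T_def)
    then have "dim T < dim S"
      using T less.prems(1) by (metis dim_psubset span_eq_iff)
    then obtain B where B: "B \<subseteq> T" "pairwise orthogonal B"
      "\<forall>b\<in>B. norm b = 1 \<and> (\<exists>c. f b = c *\<^sub>R b)" "span B = T"
      using less.hyps[OF _ T fT] by blast
    have "S \<subseteq> span (insert v B)"
    proof
      fix x assume "x \<in> S"
      then have "x - (v \<bullet> x) *\<^sub>R v \<in> T"
        using v(1) vv less.prems(1)
        by (auto simp: T_def orthogonal_def inner_diff_right subspace_diff subspace_scale)
      then show "x \<in> span (insert v B)"
        by (auto simp: span_insert B(4))
    qed
    moreover have "span (insert v B) \<subseteq> S"
      using B(1) v(1) less.prems(1) by (intro span_minimal) (auto simp: T_def)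
    moreover have "pairwise orthogonal (insert v B)"
      using B(1,2) by (auto simp: pairwise_insert T_def orthogonal_commute)
    ultimately show ?thesis
      using B(1,3) v by (intro exI[of _ "insert v B"]) (auto simp: T_def)
  qed
qed

text \<open>For orthogonal \<open>U\<close>, column \<open>i\<close> of \<open>U\<close> is an
  eigenvector with eigenvalue \<open>d i\<close>. As \<open>U\<close> stays fixed along the
  iteration, \<open>d\<close> alone encodes each residual.\<close>

definition conj_diag :: "real^'n^'n \<Rightarrow> ('n \<Rightarrow> real) \<Rightarrow> real^'n^'n" where
  "conj_diag U d = U ** (\<chi> i j. if i = j then d i else 0) ** transpose U"

lemma conj_diag_nth: "conj_diag U d $ i $ j = (\<Sum>k\<in>UNIV. U $ i $ k * d k * U $ j $ k)"
  by (simp add: conj_diag_def matrix_matrix_mult_def transpose_def if_distrib cong: if_cong)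

text \<open>The columns of \<open>U\<close> are an orthonormal eigenbasis of the whole space,
  enumerated by the index type.\<close>

lemma symmetric_matrix_diagonalizable:
  fixes M :: "real^'n^'n"
  assumes "transpose M = M"
  obtains U d where "orthogonal_matrix U" "M = conj_diag U d"
proof -
  have sa: "(M *v x) \<bullet> y = x \<bullet> (M *v y)" for x y
    by (metis assms dot_lmul_matrix transpose_matrix_vector)
  obtain B where B: "pairwise orthogonal B"
      "\<forall>b\<in>B. norm b = 1 \<and> (\<exists>c. M *v b = c *\<^sub>R b)" "span B = UNIV"
    using selfadjoint_orthonormal_eigenbasis[OF matrix_vector_mul_linear sa, of UNIV] by auto
  have "0 \<notin> B" using B(2) by force
  then have ind: "independent B"
    using B(1) pairwise_orthogonal_independent by blast
  then have "card B = CARD('n)"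
    using dim_span_eq_card_independent[of B] B(3) by (simp add: dim_UNIV)
  then obtain g where g: "bij_betw g (UNIV::'n set) B"
    by (metis ind finite_class.finite_UNIV finite_same_card_bij finiteI_independent)
  have gB: "g i \<in> B" for i using g by (auto simp: bij_betw_def)
  define U :: "real^'n^'n" where "U = (\<chi> i j. g j $ i)"
  have col: "column j U = g j" for j by (simp add: U_def column_def vec_eq_iff)
  have "orthogonal (g i) (g j)" if "i \<noteq> j" for i j
    using pairwiseD[OF B(1) gB gB] g that by (simp add: bij_betw_def inj_eq)
  then have U: "orthogonal_matrix U"
    using B(2) gB by (simp add: orthogonal_matrix_orthonormal_columns col)
  obtain d where d: "\<And>i. M *v g i = d i *\<^sub>R g i"
    using B(2)[rule_format, OF gB] by metis
  have "M ** U = U ** (\<chi> i j. if i = j then d i else 0)"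
  proof -
    have "(\<Sum>k\<in>UNIV. M $ i $ k * g j $ k) = d j * g j $ i" for i j
      using d[of j] by (simp add: vec_eq_iff matrix_vector_mult_def)
    then show ?thesis
      by (simp add: vec_eq_iff U_def matrix_matrix_mult_def if_distrib mult.commute cong: if_cong)
  qed
  then have "conj_diag U d = M ** (U ** transpose U)"
    by (simp add: conj_diag_def matrix_mul_assoc)
  also have "\<dots> = M" using U by (simp add: orthogonal_matrix_def)
  finally have "M = conj_diag U d" by (rule sym)
  with U show thesis by (rule that)
qed

section \<open>Algebra, trace, norm and eigenvectors of diagonalised matrices\<close>

lemma conj_diag_add: "conj_diag U (\<lambda>i. d i + e i) = conj_diag U d + conj_diag U e"
  by (simp add: vec_eq_iff conj_diag_nth algebra_simps sum.distrib)

lemma conj_diag_diff: "conj_diag U (\<lambda>i. d i - e i) = conj_diag U d - conj_diag U e"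
  by (simp add: vec_eq_iff conj_diag_nth algebra_simps sum_subtractf)

lemma conj_diag_scaleR: "conj_diag U (\<lambda>i. c * d i) = c *\<^sub>R conj_diag U d"
  by (simp add: vec_eq_iff conj_diag_nth sum_distrib_left mult_ac)

lemma conj_diag_one: "orthogonal_matrix U \<Longrightarrow> conj_diag U (\<lambda>i. 1) = mat 1"
  by (simp add: conj_diag_def orthogonal_matrix_def mat_def[symmetric])

lemma conj_diag_mult:
  assumes "orthogonal_matrix U"
  shows "conj_diag U d ** conj_diag U e = conj_diag U (\<lambda>i. d i * e i)"
proof -
  let ?D = "\<lambda>d. (\<chi> i j. if i = j then d i else 0) :: real^'a^'a"
  have "conj_diag U d ** conj_diag U e = U ** ?D d ** (transpose U ** U) ** ?D e ** transpose U"
    by (simp add: conj_diag_def matrix_mul_assoc)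
  also have "\<dots> = U ** (?D d ** ?D e) ** transpose U"
    using assms by (simp add: orthogonal_matrix matrix_mul_assoc)
  also have "?D d ** ?D e = ?D (\<lambda>i. d i * e i)"
  proof -
    have "(if i = k then d i else 0) * (if k = j then e k else 0)
        = (if k = i then if i = j then d i * e i else 0 else 0)" for i j k
      by auto
    then show ?thesis by (simp add: matrix_matrix_mult_def)
  qed
  finally show ?thesis by (simp add: conj_diag_def)
qed

lemma trace_conj_diag:
  assumes "orthogonal_matrix U"
  shows "trace (conj_diag U d) = sum d UNIV"
proof -
  have "trace (conj_diag U d) = trace (transpose U ** U ** (\<chi> i j. if i = j then d i else 0))"
    by (simp add: conj_diag_def trace_mul_sym[of _ "transpose U"] matrix_mul_assoc)
  then show ?thesis using assms by (simp add: orthogonal_matrix trace_def)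
qed

text \<open>By symmetry, the squared Frobenius norm is the trace of the square.\<close>

lemma norm_conj_diag:
  assumes "orthogonal_matrix U"
  shows "(norm (conj_diag U d))\<^sup>2 = (\<Sum>i\<in>UNIV. (d i)\<^sup>2)"
proof -
  have sym: "conj_diag U d $ i $ j = conj_diag U d $ j $ i" for i j
    by (simp add: conj_diag_nth mult_ac)
  have "(norm (conj_diag U d))\<^sup>2 = trace (conj_diag U d ** conj_diag U d)"
    using sym by (simp add: trace_def matrix_matrix_mult_def power2_norm_eq_inner inner_vec_def)
  then show ?thesis
    using assms by (simp add: conj_diag_mult trace_conj_diag power2_eq_square)
qed

lemma conj_diag_eigenvector:
  assumes "orthogonal_matrix U"
  shows "conj_diag U d *v column i U = d i *\<^sub>R column i U"
proof -
  let ?D = "(\<chi> i j. if i = j then d i else 0) :: real^'a^'a"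
  have "conj_diag U d *v column i U = (conj_diag U d ** U) *v axis i 1"
    by (metis matrix_vector_mul_assoc matrix_vector_mult_basis)
  also have "conj_diag U d ** U = U ** ?D"
    using assms by (simp add: conj_diag_def orthogonal_matrix matrix_mul_assoc[symmetric])
  also have "(U ** ?D) *v axis i 1 = d i *\<^sub>R column i U"
    by (simp add: matrix_vector_mult_basis vec_eq_iff column_def matrix_matrix_mult_def
        if_distrib cong: if_cong)
  finally show ?thesis .
qed

text \<open>The real eigenvector is embedded into the complex vectors; this is how
  \<open>1 \<notin> spectrum\<close> excludes the real eigenvalue 1.\<close>

lemma eigenvalue_mem_spectrum:
  fixes Q :: "real^'n^'n"
  assumes "Q *v v = c *\<^sub>R v" "v \<noteq> 0"
  shows "complex_of_real c \<in> spectrum Q"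
proof -
  have "(\<Sum>j\<in>UNIV. complex_of_real (Q $ i $ j) * complex_of_real (v $ j)) = complex_of_real (c * v $ i)" for i
    using arg_cong[OF assms(1), of "\<lambda>x. complex_of_real (x $ i)"]
    by (simp add: matrix_vector_mult_def)
  then show ?thesis
    using assms(2) unfolding spectrum_def
    by (intro CollectI exI[of _ "\<chi> i. complex_of_real (v $ i)"])
       (auto simp: vec_eq_iff matrix_vector_mult_def)
qed

subsection \<open>The iteration on eigenvalues\<close>

text \<open>Lagrange's identity for the Gram determinant; every unordered pair is counted twice,
  hence the factor 2.\<close>

lemma gram_det_eq_sum:
  fixes x y :: "'n::finite \<Rightarrow> real"
  shows "(\<Sum>i\<in>UNIV. \<Sum>j\<in>UNIV. (x i * y j - x j * y i)\<^sup>2)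
       = 2 * ((\<Sum>i\<in>UNIV. (x i)\<^sup>2) * (\<Sum>i\<in>UNIV. (y i)\<^sup>2) - (\<Sum>i\<in>UNIV. x i * y i)\<^sup>2)"
proof -
  have "(\<Sum>i\<in>UNIV. \<Sum>j\<in>UNIV. (x i * y j - x j * y i)\<^sup>2)
      = (\<Sum>i\<in>UNIV. \<Sum>j\<in>UNIV. (x i)\<^sup>2 * (y j)\<^sup>2 + (y i)\<^sup>2 * (x j)\<^sup>2
           - 2 * ((x i * y i) * (x j * y j)))"
    by (intro sum.cong refl) (simp add: power2_eq_square algebra_simps)
  also have "\<dots> = (\<Sum>i\<in>UNIV. (x i)\<^sup>2) * (\<Sum>i\<in>UNIV. (y i)\<^sup>2)
      + (\<Sum>i\<in>UNIV. (y i)\<^sup>2) * (\<Sum>i\<in>UNIV. (x i)\<^sup>2) - 2 * ((\<Sum>i\<in>UNIV. x i * y i) * (\<Sum>i\<in>UNIV. x i * y i))"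
    by (simp only: sum.distrib sum_subtractf sum_distrib_left[symmetric] sum_distrib_right[symmetric])
  finally show ?thesis by (simp add: power2_eq_square algebra_simps)
qed

text \<open>A vanishing Gram determinant kills every 2x2 minor, and the minor of \<open>i\<close>,
  \<open>j\<close> factors as \<open>(1 - d i) * (1 - d j) * (d j - d i)\<close>.\<close>

lemma gram_det_zero_imp_const:
  fixes d :: "'n::finite \<Rightarrow> real"
  assumes "\<And>i. d i \<noteq> 1"
    and "(\<Sum>i\<in>UNIV. (1 - d i)\<^sup>2) * (\<Sum>i\<in>UNIV. (1 - d i * d i)\<^sup>2)
          = (\<Sum>i\<in>UNIV. (1 - d i * d i) * (1 - d i))\<^sup>2"
  shows "d i = d j"
proof -
  have "(\<Sum>i\<in>UNIV. \<Sum>j\<in>UNIV. ((1 - d i) * (1 - d j * d j) - (1 - d j) * (1 - d i * d i))\<^sup>2) = 0"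
    using assms(2) by (simp add: gram_det_eq_sum mult.commute)
  then have "(1 - d i) * (1 - d j * d j) - (1 - d j) * (1 - d i * d i) = 0"
    by (simp add: sum_nonneg_eq_0_iff sum_nonneg)
  then have "(1 - d i) * (1 - d j) * (d j - d i) = 0"
    by (simp add: algebra_simps)
  then show ?thesis using assms(1) by simp
qed

text \<open>Cramer's rule for the normal equations of approximating the constant 1 by
  \<open>x\<close> and \<open>y\<close>. With \<open>x = 1 - \<lambda>\<close> and
  \<open>y = 1 - \<lambda>\<^sup>2\<close>, \<open>a\<close> and \<open>b\<close> are the
  coefficients of the method.\<close>

lemma least_squares_orthogonal:
  fixes x y :: "'n::finite \<Rightarrow> real"
  defines "D \<equiv> (\<Sum>i\<in>UNIV. (x i)\<^sup>2) * (\<Sum>i\<in>UNIV. (y i)\<^sup>2) - (\<Sum>i\<in>UNIV. y i * x i)\<^sup>2"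
  defines "a \<equiv> ((\<Sum>i\<in>UNIV. (y i)\<^sup>2) * sum x UNIV - sum y UNIV * (\<Sum>i\<in>UNIV. y i * x i)) / D"
  defines "b \<equiv> ((\<Sum>i\<in>UNIV. (x i)\<^sup>2) * sum y UNIV - sum x UNIV * (\<Sum>i\<in>UNIV. y i * x i)) / D"
  assumes "D \<noteq> 0"
  shows "(\<Sum>i\<in>UNIV. (1 - a * x i - b * y i) * x i) = 0"
    and "(\<Sum>i\<in>UNIV. (1 - a * x i - b * y i) * y i) = 0"
proof -
  define P Q R where "P = (\<Sum>i\<in>UNIV. (x i)\<^sup>2)" "Q = (\<Sum>i\<in>UNIV. (y i)\<^sup>2)" "R = (\<Sum>i\<in>UNIV. y i * x i)"
  note defs = P_Q_R_def
  have D: "D = P * Q - R\<^sup>2" by (simp add: D_def defs)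
  have aD: "a * D = Q * sum x UNIV - sum y UNIV * R" and bD: "b * D = P * sum y UNIV - sum x UNIV * R"
    using \<open>D \<noteq> 0\<close> by (simp_all add: a_def b_def defs)
  have "(\<Sum>i\<in>UNIV. (1 - a * x i - b * y i) * x i) = sum x UNIV - a * P - b * R"
    by (simp add: defs algebra_simps sum_subtractf sum.distrib sum_distrib_left power2_eq_square)
  moreover have "(sum x UNIV - a * P - b * R) * D = sum x UNIV * D - (a * D) * P - (b * D) * R"
    by (simp add: algebra_simps)
  moreover have "\<dots> = 0" unfolding aD bD by (simp add: D algebra_simps power2_eq_square)
  ultimately show "(\<Sum>i\<in>UNIV. (1 - a * x i - b * y i) * x i) = 0"
    using \<open>D \<noteq> 0\<close> by simp
  have "(\<Sum>i\<in>UNIV. (1 - a * x i - b * y i) * y i) = sum y UNIV - a * R - b * Q"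
    by (simp add: defs algebra_simps sum_subtractf sum.distrib sum_distrib_left power2_eq_square)
  moreover have "(sum y UNIV - a * R - b * Q) * D = sum y UNIV * D - (a * D) * R - (b * D) * Q"
    by (simp add: algebra_simps)
  moreover have "\<dots> = 0" unfolding aD bD by (simp add: D algebra_simps power2_eq_square)
  ultimately show "(\<Sum>i\<in>UNIV. (1 - a * x i - b * y i) * y i) = 0"
    using \<open>D \<noteq> 0\<close> by simp
qed

text \<open>The old residual \<open>d\<close> belongs to the coefficients 1 and 0, so
  \<open>d - e\<close> is a combination of \<open>1 - d\<close> and \<open>1 - d * d\<close>, to
  both of which \<open>e\<close> is orthogonal.\<close>

lemma residual_pythagoras:
  fixes d e :: "'n::finite \<Rightarrow> real"
  assumes e: "\<And>i. e i = 1 - a * (1 - d i) - b * (1 - d i * d i)"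
    and "(\<Sum>i\<in>UNIV. e i * (1 - d i)) = 0"
    and "(\<Sum>i\<in>UNIV. e i * (1 - d i * d i)) = 0"
  shows "(\<Sum>i\<in>UNIV. (d i)\<^sup>2) = (\<Sum>i\<in>UNIV. (e i)\<^sup>2) + (\<Sum>i\<in>UNIV. (d i - e i)\<^sup>2)"
proof -
  have "(d i)\<^sup>2 = (e i)\<^sup>2 + (d i - e i)\<^sup>2 + 2 * (e i * (d i - e i))" for i
    by (simp add: power2_eq_square algebra_simps)
  moreover have "e i * (d i - e i) = (a - 1) * (e i * (1 - d i)) + b * (e i * (1 - d i * d i))" for i
  proof -
    have diff: "d i - e i = (a - 1) * (1 - d i) + b * (1 - d i * d i)"
      by (simp add: e algebra_simps)
    show ?thesis unfolding diff by (simp add: algebra_simps)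
  qed
  ultimately show ?thesis
    using assms(2,3) by (simp add: sum.distrib flip: sum_distrib_left)
qed

lemma geometric_escape:
  fixes u :: "nat \<Rightarrow> real"
  assumes "c > 1" "\<And>j. c * \<bar>u j\<bar> \<le> \<bar>u (Suc j)\<bar>" "u 0 \<noteq> 0"
  shows "\<exists>j. \<bar>u j\<bar> > B"
proof -
  have lb: "c ^ j * \<bar>u 0\<bar> \<le> \<bar>u j\<bar>" for j
  proof (induction j)
    case (Suc j)
    then have "c * (c ^ j * \<bar>u 0\<bar>) \<le> c * \<bar>u j\<bar>" using assms(1) by (intro mult_left_mono) auto
    with assms(2)[of j] show ?case by (simp add: mult.assoc)
  qed simp
  obtain j where "B / \<bar>u 0\<bar> < c ^ j" using real_arch_pow[OF assms(1)] by blast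
  then have "B < c ^ j * \<bar>u 0\<bar>" using assms(3) by (simp add: pos_divide_less_eq)
  with lb[of j] show ?thesis by (intro exI[of _ j]) linarith
qed

lemma nondegenerate_iteration_tendsto_zero:
  fixes l :: "nat \<Rightarrow> 'n::finite \<Rightarrow> real"
  assumes step: "\<And>k i. l (Suc k) i = 1 - a k * (1 - l k i) - b k * (1 - l k i * l k i)"
    and orth1: "\<And>k. (\<Sum>i\<in>UNIV. l (Suc k) i * (1 - l k i)) = 0"
    and orth2: "\<And>k. (\<Sum>i\<in>UNIV. l (Suc k) i * (1 - l k i * l k i)) = 0"
    and init: "(\<Sum>i\<in>UNIV. (l 0 i)\<^sup>2) < CARD('n)"
    and ne1: "\<And>k i. l k i \<noteq> 1"
    and m: "m > 0" "\<And>k. k \<ge> K \<Longrightarrow> b k > m"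
  shows "(\<lambda>k. l k i) \<longlonglongrightarrow> 0"
proof -

  \<comment> \<open>Decreasing norms and vanishing steps\<close>
  define S where "S k = (\<Sum>i\<in>UNIV. (l k i)\<^sup>2)" for k
  define n where "n = real CARD('n)"
  have dec: "S k = S (Suc k) + (\<Sum>i\<in>UNIV. (l k i - l (Suc k) i)\<^sup>2)" for k
    unfolding S_def by (rule residual_pythagoras[OF step orth1 orth2])
  have "decseq S"
  proof (rule decseq_SucI)
    show "S (Suc k) \<le> S k" for k
      using dec[of k] by (simp add: sum_nonneg)
  qed
  moreover have S0: "S k \<ge> 0" for k by (simp add: S_def sum_nonneg)
  ultimately obtain L where "S \<longlonglongrightarrow> L"
    using decseq_convergent by blast
  have le0: "S k \<le> S 0" for k using \<open>decseq S\<close> by (simp add: decseqD)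
  have sq: "(l k i)\<^sup>2 \<le> S 0" for k i
  proof -
    have "(l k i)\<^sup>2 \<le> S k" unfolding S_def by (rule member_le_sum) auto
    with le0[of k] show ?thesis by simp
  qed
  have bnd: "\<bar>l k i\<bar> \<le> sqrt (S 0)" for k i
    using real_sqrt_le_mono[OF sq[of k i]] by simp
  have bnd1: "\<bar>1 - l k i\<bar> \<le> 1 + sqrt (S 0)" for k i
    using bnd[of k i] by linarith
  have "(\<lambda>k. S k - S (Suc k)) \<longlonglongrightarrow> L - L"
    using \<open>S \<longlonglongrightarrow> L\<close> by (intro tendsto_intros) (auto simp: LIMSEQ_Suc)
  then have "(\<lambda>k. \<Sum>i\<in>UNIV. (l k i - l (Suc k) i)\<^sup>2) \<longlonglongrightarrow> 0"
  proof -
    have "S k - S (Suc k) = (\<Sum>i\<in>UNIV. (l k i - l (Suc k) i)\<^sup>2)" for k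
      using dec[of k] by simp
    with \<open>(\<lambda>k. S k - S (Suc k)) \<longlonglongrightarrow> L - L\<close> show ?thesis by simp
  qed
  then have "(\<lambda>k. (l k i - l (Suc k) i)\<^sup>2) \<longlonglongrightarrow> 0" for i
    by (rule Lim_null_comparison[rotated])
      (intro always_eventually allI, simp, rule member_le_sum, auto)
  then have diff: "(\<lambda>k. l k i - l (Suc k) i) \<longlonglongrightarrow> 0" for i
    using tendsto_real_sqrt[of "\<lambda>k. (l k i - l (Suc k) i)\<^sup>2" 0 sequentially for i]
    by (simp add: tendsto_rabs_zero_iff)

  \<comment> \<open>Factorisation of the step\<close>
  define r where "r k = (1 - a k - b k) / b k" for k
  have bpos: "b k > 0" if "k \<ge> K" for k using m(1) m(2)[OF that] by simp
  have br: "1 - a k - b k = b k * r k" if "k \<ge> K" for k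
    using bpos[OF that] by (simp add: r_def)
  \<comment> \<open>The step is quadratic in the eigenvalue, with roots 1 and \<open>r k\<close>,
    the fixed points of the scalar map.\<close>
  have factor: "l k i - l (Suc k) i = b k * ((1 - l k i) * (l k i - r k))" if "k \<ge> K" for k i
  proof -
    have "l k i - l (Suc k) i = (1 - l k i) * (b k * l k i - (1 - a k - b k))"
      by (simp add: step algebra_simps)
    also have "\<dots> = b k * ((1 - l k i) * (l k i - r k))"
      unfolding br[OF that] by (simp add: algebra_simps)
    finally show ?thesis .
  qed
  have expand: "1 - l (Suc k) i = (1 - l k i) * (1 + b k * (l k i - r k))" if "k \<ge> K" for k i
    using factor[OF that, of i] by (simp add: algebra_simps)
  have lim1: "(\<lambda>k. (1 - l k i) * (l k i - r k)) \<longlonglongrightarrow> 0" for i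
  proof (rule Lim_null_comparison)
    show "\<forall>\<^sub>F k in sequentially. norm ((1 - l k i) * (l k i - r k)) \<le> \<bar>l k i - l (Suc k) i\<bar> / m"
    proof (rule eventually_sequentiallyI)
      fix k assume "k \<ge> K"
      then have "\<bar>(1 - l k i) * (l k i - r k)\<bar> * m \<le> \<bar>(1 - l k i) * (l k i - r k)\<bar> * b k"
        using m(2)[of k] by (intro mult_left_mono) auto
      also have "\<dots> = \<bar>l k i - l (Suc k) i\<bar>"
        using bpos[OF \<open>k \<ge> K\<close>] by (simp add: factor[OF \<open>k \<ge> K\<close>] abs_mult)
      finally show "norm ((1 - l k i) * (l k i - r k)) \<le> \<bar>l k i - l (Suc k) i\<bar> / m"
        using m(1) by (simp add: pos_le_divide_eq)
    qed
    show "(\<lambda>k. \<bar>l k i - l (Suc k) i\<bar> / m) \<longlonglongrightarrow> 0"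
      using tendsto_divide[OF tendsto_rabs[OF diff[of i]] tendsto_const[of m]] m(1) by simp
  qed
  have bounded_mult: "(\<lambda>k. f k * (1 - l k i)) \<longlonglongrightarrow> 0" if "f \<longlonglongrightarrow> 0" for f i
  proof (rule Lim_null_comparison)
    show "\<forall>\<^sub>F k in sequentially. norm (f k * (1 - l k i)) \<le> \<bar>f k\<bar> * (1 + sqrt (S 0))"
      using bnd1 by (intro always_eventually allI) (simp add: abs_mult mult_left_mono)
    show "(\<lambda>k. \<bar>f k\<bar> * (1 + sqrt (S 0))) \<longlonglongrightarrow> 0"
      using tendsto_mult[OF tendsto_rabs[OF that] tendsto_const[of "1 + sqrt (S 0)"]] by simp
  qed
  \<comment> \<open>By \<open>orth1\<close> the first sum equals the sum of
    \<open>l k i * (1 - l k i)\<close>; subtracting the second sum then isolates \<open>r k\<close>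
    times the trace gap.\<close>
  have "(\<lambda>k. \<Sum>i\<in>UNIV. (l k i - l (Suc k) i) * (1 - l k i)) \<longlonglongrightarrow> (\<Sum>(i::'n)\<in>UNIV. 0)"
    by (intro tendsto_sum bounded_mult diff)
  moreover have "(\<lambda>k. \<Sum>i\<in>UNIV. (1 - l k i) * (l k i - r k)) \<longlonglongrightarrow> (\<Sum>(i::'n)\<in>UNIV. 0)"
    by (intro tendsto_sum lim1)
  ultimately have "(\<lambda>k. (\<Sum>i\<in>UNIV. (l k i - l (Suc k) i) * (1 - l k i))
      - (\<Sum>i\<in>UNIV. (1 - l k i) * (l k i - r k))) \<longlonglongrightarrow> 0 - 0"
    by (intro tendsto_diff) auto
  moreover have "(\<Sum>i\<in>UNIV. (l k i - l (Suc k) i) * (1 - l k i))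
      - (\<Sum>i\<in>UNIV. (1 - l k i) * (l k i - r k)) = r k * (\<Sum>i\<in>UNIV. 1 - l k i)" for k
  proof -
    have "r k * (\<Sum>i\<in>UNIV. 1 - l k i) = (\<Sum>i\<in>UNIV. (l k i - l (Suc k) i) * (1 - l k i)
        + l (Suc k) i * (1 - l k i) - (1 - l k i) * (l k i - r k))"
      unfolding sum_distrib_left by (intro sum.cong refl) (simp add: algebra_simps)
    then show ?thesis using orth1[of k] by (simp only: sum.distrib sum_subtractf)
  qed
  ultimately have rlim': "(\<lambda>k. r k * (\<Sum>i\<in>UNIV. 1 - l k i)) \<longlonglongrightarrow> 0" by simp

  \<comment> \<open>Trace gap and the limit of \<open>r\<close>\<close>
  define \<delta> where "\<delta> = n - sqrt (n * S 0)"
  have npos: "n > 0" by (simp add: n_def)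
  \<comment> \<open>The strict bound \<open>S 0 < n\<close> makes the Cauchy-Schwarz bound
    \<open>sqrt (n * S 0)\<close> on the trace smaller than \<open>n\<close>.\<close>
  have "sqrt (n * S 0) < sqrt (n * n)"
    using init npos by (intro real_sqrt_less_mono mult_strict_left_mono) (auto simp: S_def n_def)
  then have "\<delta> > 0" using npos by (simp add: \<delta>_def)
  \<comment> \<open>This rules out that all eigenvalues tend to 1.\<close>
  have gap: "\<delta> \<le> (\<Sum>i\<in>UNIV. 1 - l k i)" for k
  proof -
    have "(\<Sum>i\<in>UNIV. l k i * 1)\<^sup>2 \<le> S k * (\<Sum>i\<in>(UNIV::'n set). 1\<^sup>2)"
      unfolding S_def by (rule Cauchy_Schwarz_ineq_sum)
    also have "\<dots> \<le> S 0 * n" using le0[of k] by (simp add: n_def mult_right_mono)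
    finally have "(\<Sum>i\<in>UNIV. l k i) \<le> sqrt (n * S 0)"
      by (intro real_le_rsqrt) (simp add: mult.commute)
    then show ?thesis by (simp add: \<delta>_def n_def sum_subtractf)
  qed
  have rlim: "r \<longlonglongrightarrow> 0"
  proof (rule Lim_null_comparison)
    show "\<forall>\<^sub>F k in sequentially. norm (r k) \<le> \<bar>r k * (\<Sum>i\<in>UNIV. 1 - l k i)\<bar> / \<delta>"
    proof (intro always_eventually allI)
      fix k
      have "\<bar>r k\<bar> * \<delta> \<le> \<bar>r k\<bar> * \<bar>\<Sum>i\<in>UNIV. 1 - l k i\<bar>"
        using gap[of k] by (intro mult_left_mono) linarith+
      then show "norm (r k) \<le> \<bar>r k * (\<Sum>i\<in>UNIV. 1 - l k i)\<bar> / \<delta>"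
        using \<open>\<delta> > 0\<close> by (simp only: pos_le_divide_eq abs_mult real_norm_def)
    qed
    show "(\<lambda>k. \<bar>r k * (\<Sum>i\<in>UNIV. 1 - l k i)\<bar> / \<delta>) \<longlonglongrightarrow> 0"
      using tendsto_divide[OF tendsto_rabs[OF rlim'] tendsto_const[of \<delta>]] \<open>\<delta> > 0\<close> by simp
  qed
  have "(\<lambda>k. (1 - l k i) * (l k i - r k) + r k * (1 - l k i)) \<longlonglongrightarrow> 0 + 0"
    by (intro tendsto_add lim1 bounded_mult rlim)
  then have prod: "(\<lambda>k. l k i * (1 - l k i)) \<longlonglongrightarrow> 0"
    by (simp add: algebra_simps)

  \<comment> \<open>Exclusion of the limit point 1\<close>
  have small: "\<forall>\<^sub>F k in sequentially. \<bar>f k\<bar> < e" if "f \<longlonglongrightarrow> 0" "e > 0" for f :: "nat \<Rightarrow> real" and e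
    using tendstoD[OF that] by simp
  \<comment> \<open>Above 1/2, the bound 1/8 forces distance below 1/4 from 1. Then a step below 1/4
    stays above 1/2, and \<open>l k i - r k\<close> exceeds 3/4 - 1/4 = 1/2, which yields the growth
    factor \<open>1 + m/2\<close>.\<close>
  have "\<forall>\<^sub>F k in sequentially. k \<ge> K \<and> \<bar>l k i * (1 - l k i)\<bar> < 1/8 \<and> \<bar>r k\<bar> < 1/4
      \<and> \<bar>l k i - l (Suc k) i\<bar> < 1/4"
    by (intro eventually_conj eventually_ge_at_top small prod rlim diff) auto
  then obtain N where N: "\<And>k. k \<ge> N \<Longrightarrow> k \<ge> K \<and> \<bar>l k i * (1 - l k i)\<bar> < 1/8 \<and> \<bar>r k\<bar> < 1/4
      \<and> \<bar>l k i - l (Suc k) i\<bar> < 1/4"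
    by (auto simp: eventually_sequentially)
  have near1: "\<bar>1 - l k i\<bar> < 1/4" if "k \<ge> N" "l k i > 1/2" for k
  proof -
    have "1/2 * \<bar>1 - l k i\<bar> \<le> \<bar>l k i\<bar> * \<bar>1 - l k i\<bar>"
      using that(2) by (intro mult_right_mono) auto
    then show ?thesis using N[OF that(1)] by (simp add: abs_mult)
  qed
  have stay: "l (Suc k) i > 1/2" if "k \<ge> N" "l k i > 1/2" for k
    using near1[OF that] N[OF that(1)] by linarith
  have grow: "(1 + m/2) * \<bar>1 - l k i\<bar> \<le> \<bar>1 - l (Suc k) i\<bar>" if "k \<ge> N" "l k i > 1/2" for k
  proof -
    have "k \<ge> K" using N[OF that(1)] by simp
    have "m * (1/2) \<le> b k * (l k i - r k)"
      using m(1) m(2)[OF \<open>k \<ge> K\<close>] near1[OF that] N[OF that(1)] by (intro mult_mono) linarith+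
    then have "(1 + m/2) * \<bar>1 - l k i\<bar> \<le> \<bar>1 + b k * (l k i - r k)\<bar> * \<bar>1 - l k i\<bar>"
      by (intro mult_right_mono) auto
    then show ?thesis by (simp add: expand[OF \<open>k \<ge> K\<close>] abs_mult mult.commute)
  qed
  \<comment> \<open>The fixed point 1 is repelling, so no eigenvalue can linger near it.\<close>
  have low: "l k i \<le> 1/2" if "k \<ge> N" for k
  proof (rule ccontr)
    assume "\<not> l k i \<le> 1/2"
    have half: "l (k + j) i > 1/2" for j
    proof (induction j)
      case (Suc j)
      then show ?case using stay[of "k + j"] that by simp
    qed (use \<open>\<not> l k i \<le> 1/2\<close> in simp)
    have "(1 + m/2) * \<bar>1 - l (k + j) i\<bar> \<le> \<bar>1 - l (k + Suc j) i\<bar>" for j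
      using grow[OF _ half[of j]] that by simp
    \<comment> \<open>\<open>ne1\<close> makes the initial distance to 1 non-zero, so it must
      outgrow the bound 1/4 of \<open>near1\<close>.\<close>
    then obtain j where "\<bar>1 - l (k + j) i\<bar> > 1/4"
      using geometric_escape[of "1 + m/2" "\<lambda>j. 1 - l (k + j) i" "1/4"] m(1) ne1[of k i] by auto
    then show False
      using near1[OF _ half[of j]] that by simp
  qed
  \<comment> \<open>Below 1/2 the factor \<open>1 - l k i\<close> is at least 1/2, so the vanishing
    product controls \<open>l k i\<close>.\<close>
  have "\<forall>\<^sub>F k in sequentially. norm (l k i) \<le> 2 * \<bar>l k i * (1 - l k i)\<bar>"
  proof (rule eventually_sequentiallyI)
    fix k assume "k \<ge> N"
    then have "\<bar>l k i\<bar> * (1/2) \<le> \<bar>l k i\<bar> * \<bar>1 - l k i\<bar>"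
      using low[of k] by (intro mult_left_mono) linarith+
    then show "norm (l k i) \<le> 2 * \<bar>l k i * (1 - l k i)\<bar>" by (simp add: abs_mult)
  qed
  moreover have "(\<lambda>k. 2 * \<bar>l k i * (1 - l k i)\<bar>) \<longlonglongrightarrow> 0"
    using tendsto_mult[OF tendsto_const[of 2] tendsto_rabs[OF prod]] by simp
  ultimately show ?thesis by (rule Lim_null_comparison)
qed

subsection \<open>From matrices to eigenvalues\<close>

lemma one_minus_conj_diag:
  assumes "orthogonal_matrix U"
  shows "mat 1 - conj_diag U d = conj_diag U (\<lambda>i. 1 - d i)"
    and "mat 1 - conj_diag U d ** conj_diag U d = conj_diag U (\<lambda>i. 1 - d i * d i)"
  using assms by (simp_all add: conj_diag_diff conj_diag_one conj_diag_mult)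

lemma SSHP2_D_conj_diag:
  assumes "orthogonal_matrix U"
  shows "SSHP2_D (conj_diag U d) =
    (\<Sum>i\<in>UNIV. (1 - d i)\<^sup>2) * (\<Sum>i\<in>UNIV. (1 - d i * d i)\<^sup>2)
      - (\<Sum>i\<in>UNIV. (1 - d i * d i) * (1 - d i))\<^sup>2"
  using assms by (simp add: SSHP2_D_def one_minus_conj_diag norm_conj_diag conj_diag_mult trace_conj_diag)

text \<open>Left multiplication of the update by \<open>A\<close> turns \<open>A ** X\<close> into
  \<open>mat 1 - F\<close>, so the residuals obey a recursion of their own.\<close>

lemma SSHP2_F_step:
  fixes A X0 :: "real^'n^'n" and k :: nat
  defines "F \<equiv> SSHP2_F A X0 k"
  shows "SSHP2_F A X0 (Suc k) =
    mat 1 - (mat 1 - F) ** ((SSHP2_\<alpha> F + SSHP2_\<beta> F) *\<^sub>R mat 1 + SSHP2_\<beta> F *\<^sub>R F)"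
  by (simp add: F_def SSHP2_F_def Let_def matrix_mul_assoc)

text \<open>Eigenvalues are indexed by the columns of \<open>U\<close>, not by size, so each follows
  its own scalar recursion, coupled only through the coefficients.\<close>

fun SSHP2_eigenvalues :: "real^'n^'n \<Rightarrow> ('n \<Rightarrow> real) \<Rightarrow> nat \<Rightarrow> 'n \<Rightarrow> real" where
  "SSHP2_eigenvalues U d 0 i = d i"
| "SSHP2_eigenvalues U d (Suc k) i =
     (let e = SSHP2_eigenvalues U d k; F = conj_diag U e
      in 1 - SSHP2_\<alpha> F * (1 - e i) - SSHP2_\<beta> F * (1 - e i * e i))"

lemma SSHP2_F_eq_conj_diag:
  assumes "orthogonal_matrix U" "SSHP2_F A X0 0 = conj_diag U d"
  shows "SSHP2_F A X0 k = conj_diag U (SSHP2_eigenvalues U d k)"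
proof (induction k)
  case 0
  then show ?case using assms(2) by (simp add: SSHP2_eigenvalues.simps(1)[abs_def])
next
  case (Suc k)
  let ?e = "SSHP2_eigenvalues U d k"
  let ?F = "conj_diag U ?e"
  let ?a = "SSHP2_\<alpha> ?F" and ?b = "SSHP2_\<beta> ?F"
  have "(?a + ?b) *\<^sub>R mat 1 + ?b *\<^sub>R ?F = conj_diag U (\<lambda>i. (?a + ?b) * 1 + ?b * ?e i)"
    by (simp only: conj_diag_add conj_diag_scaleR conj_diag_one[OF assms(1)])
  then have "SSHP2_F A X0 (Suc k) =
      conj_diag U (\<lambda>i. 1 - (1 - ?e i) * ((?a + ?b) * 1 + ?b * ?e i))"
    using assms(1) by (simp only: SSHP2_F_step Suc one_minus_conj_diag conj_diag_mult)
  also have "(\<lambda>i. 1 - (1 - ?e i) * ((?a + ?b) * 1 + ?b * ?e i)) = SSHP2_eigenvalues U d (Suc k)"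
    by (simp add: fun_eq_iff Let_def algebra_simps)
  finally show ?case .
qed

text \<open>For a unit eigenvector \<open>v\<close> and \<open>w = transpose A *v v\<close>, both
  \<open>\<alpha> * (norm w)\<^sup>2\<close> and \<open>\<alpha> * norm (A *v w)\<close> equal
  \<open>1 - d i\<close>. Hence \<open>(norm w)\<^sup>2 = norm (A *v w)\<close>, so
  \<open>norm w\<close> is at most the spectral norm of \<open>A\<close>.\<close>

lemma initial_residual_eigenvalues:
  fixes A :: "real^'n^'n"
  assumes "0 < \<alpha>" "\<alpha> < 2 / (onorm ((*v) A))\<^sup>2"
    and U: "orthogonal_matrix U" "mat 1 - A ** (\<alpha> *\<^sub>R transpose A) = conj_diag U d"
  shows "-1 < d i" "d i \<le> 1"
proof -
  let ?N = "onorm ((*v) A)"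
  define v where "v = column i U"
  define w where "w = transpose A *v v"
  have "norm v = 1"
    using U(1) by (simp add: v_def orthogonal_matrix_orthonormal_columns)
  then have vv: "v \<bullet> v = 1" by (simp add: norm_eq_1)
  have "(mat 1 - A ** (\<alpha> *\<^sub>R transpose A)) *v v = d i *\<^sub>R v"
    unfolding U(2) v_def by (rule conj_diag_eigenvector[OF U(1)])
  then have Aw: "\<alpha> *\<^sub>R (A *v w) = (1 - d i) *\<^sub>R v"
    by (simp add: w_def matrix_vector_mult_diff_rdistrib matrix_vector_mul_assoc[symmetric]
        scaleR_matrix_vector_assoc[symmetric] matrix_vector_mult_scaleR algebra_simps
        del: transpose_matrix_vector)
  have "w \<bullet> w = v \<bullet> (A *v w)"
    by (simp add: w_def dot_lmul_matrix)
  then have ww: "\<alpha> * (norm w)\<^sup>2 = 1 - d i"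
    using arg_cong[OF Aw, of "inner v"] vv by (simp add: power2_norm_eq_inner)
  then show "d i \<le> 1" using assms(1) by (smt (verit) zero_le_power2 mult_nonneg_nonneg)
  have "norm (A *v w) \<le> ?N * norm w"
    by (intro onorm matrix_vector_mul_bounded_linear)
  moreover have "\<alpha> * norm (A *v w) = 1 - d i"
    using arg_cong[OF Aw, of norm] \<open>norm v = 1\<close> \<open>d i \<le> 1\<close> assms(1) by simp
  ultimately have "(norm w)\<^sup>2 \<le> ?N * norm w"
    using ww assms(1) by (metis mult_left_cancel order_less_irrefl)
  then have "norm w \<le> ?N"
    by (cases "norm w = 0") (auto simp: power2_eq_square onorm_pos_le)
  then have "\<alpha> * (norm w)\<^sup>2 \<le> \<alpha> * ?N\<^sup>2"
    using assms(1) by (intro mult_left_mono power_mono) auto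
  \<comment> \<open>Division by 0 gives 0, so a zero norm would contradict
    \<open>0 < \<alpha>\<close>.\<close>
  moreover have "?N \<noteq> 0" using assms(1,2) by auto
  then have "\<alpha> * ?N\<^sup>2 < 2"
    using assms(2) by (simp add: pos_less_divide_eq)
  ultimately show "-1 < d i" using ww by simp
qed

theorem theorem3p6:
  fixes A X0 :: "real^'n^'n" and \<alpha> :: real
  assumes "invertible A"
    and "0 < \<alpha>" and "\<alpha> < 2 / (onorm ((*v) A))\<^sup>2"
    and "X0 = \<alpha> *\<^sub>R transpose A"
    and "\<forall>k. 1 \<notin> spectrum (SSHP2_F A X0 k)"
    and "\<exists>(l::nat) (m::real). 0 < m \<and> (\<forall>k\<ge>l. SSHP2_\<beta> (SSHP2_F A X0 k) > m)"
  shows "SSHP2_converges A X0"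
proof -
  have "transpose (SSHP2_F A X0 0) = SSHP2_F A X0 0"
    by (simp add: SSHP2_F_def assms(4) vec_eq_iff transpose_def matrix_matrix_mult_def mat_def mult_ac)
  then obtain U d where U: "orthogonal_matrix U" and F0: "SSHP2_F A X0 0 = conj_diag U d"
    by (rule symmetric_matrix_diagonalizable)
  define l where "l = SSHP2_eigenvalues U d"
  have F: "SSHP2_F A X0 k = conj_diag U (l k)" for k
    unfolding l_def by (rule SSHP2_F_eq_conj_diag[OF U F0])
  define D where "D k = SSHP2_D (conj_diag U (l k))" for k
  define a where "a k = SSHP2_\<alpha> (conj_diag U (l k))" for k
  define b where "b k = SSHP2_\<beta> (conj_diag U (l k))" for k
  have step: "l (Suc k) i = 1 - a k * (1 - l k i) - b k * (1 - l k i * l k i)" for k i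
    by (simp add: l_def a_def b_def Let_def)
  have D: "D k = (\<Sum>i\<in>UNIV. (1 - l k i)\<^sup>2) * (\<Sum>i\<in>UNIV. (1 - l k i * l k i)\<^sup>2)
      - (\<Sum>i\<in>UNIV. (1 - l k i * l k i) * (1 - l k i))\<^sup>2" for k
    unfolding D_def by (rule SSHP2_D_conj_diag[OF U])
  have ne1: "l k i \<noteq> 1" for k i
  proof
    assume "l k i = 1"
    moreover have "column i U \<noteq> 0"
      using U by (metis norm_zero orthogonal_matrix_orthonormal_columns zero_neq_one)
    ultimately have "1 \<in> spectrum (SSHP2_F A X0 k)"
      using eigenvalue_mem_spectrum[OF conj_diag_eigenvector[OF U, of "l k" i]] by (simp add: F)
    with assms(5) show False by blast
  qed
  have init: "(\<Sum>i\<in>UNIV. (l 0 i)\<^sup>2) < CARD('n)"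
  proof -
    have "(l 0 i)\<^sup>2 < 1" for i
      using initial_residual_eigenvalues[OF assms(2,3) U, of d i] F0 ne1[of 0 i]
      by (simp add: SSHP2_F_def assms(4) l_def abs_square_less_1)
    then have "(\<Sum>i\<in>UNIV. (l 0 i)\<^sup>2) < (\<Sum>(i::'n)\<in>UNIV. 1)"
      by (intro sum_strict_mono) auto
    then show ?thesis by simp
  qed
  have orth: "(\<Sum>i\<in>UNIV. l (Suc k) i * (1 - l k i)) = 0"
    "(\<Sum>i\<in>UNIV. l (Suc k) i * (1 - l k i * l k i)) = 0" if "D k \<noteq> 0" for k
  proof -
    note ls = least_squares_orthogonal[where x = "\<lambda>i. 1 - l k i" and y = "\<lambda>i. 1 - l k i * l k i",
        folded D, OF that]
    \<comment> \<open>In the branch \<open>D k \<noteq> 0\<close> the coefficients of the method are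
      exactly Cramer's solution, so \<open>ls\<close> applies to \<open>l (Suc k)\<close>.\<close>
    have ab: "a k = ((\<Sum>i\<in>UNIV. (1 - l k i * l k i)\<^sup>2) * (\<Sum>i\<in>UNIV. 1 - l k i)
        - (\<Sum>i\<in>UNIV. 1 - l k i * l k i) * (\<Sum>i\<in>UNIV. (1 - l k i * l k i) * (1 - l k i))) / D k"
      "b k = ((\<Sum>i\<in>UNIV. (1 - l k i)\<^sup>2) * (\<Sum>i\<in>UNIV. 1 - l k i * l k i)
        - (\<Sum>i\<in>UNIV. 1 - l k i) * (\<Sum>i\<in>UNIV. (1 - l k i * l k i) * (1 - l k i))) / D k"
      using that U unfolding a_def b_def D_def SSHP2_\<alpha>_def SSHP2_\<beta>_def
      by (simp_all only: one_minus_conj_diag norm_conj_diag conj_diag_mult trace_conj_diag if_False)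
    show "(\<Sum>i\<in>UNIV. l (Suc k) i * (1 - l k i)) = 0"
      "(\<Sum>i\<in>UNIV. l (Suc k) i * (1 - l k i * l k i)) = 0"
      unfolding step using ls[folded ab] by simp_all
  qed
  have lim: "(\<lambda>k. l k i) \<longlonglongrightarrow> 0" for i
  proof (cases "\<exists>k. D k = 0")
    case False
    obtain K m where "0 < m" "\<And>k. k \<ge> K \<Longrightarrow> b k > m"
      using assms(6) unfolding F b_def by blast
    with False show ?thesis
      by (intro nondegenerate_iteration_tendsto_zero[OF step _ _ init ne1]) (auto intro: orth)
  next
    case True
    \<comment> \<open>Before the first degenerate index the normal equations hold, so the initial
      norm bound survives up to \<open>K\<close>.\<close>
    define K where "K = (LEAST k. D k = 0)"
    have DK: "D K = 0" unfolding K_def using True by (auto intro: LeastI)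
    have nz: "D k \<noteq> 0" if "k < K" for k
      using not_less_Least that unfolding K_def by blast
    have dec: "(\<Sum>i\<in>UNIV. (l k i)\<^sup>2) \<le> (\<Sum>i\<in>UNIV. (l 0 i)\<^sup>2)" if "k \<le> K" for k
      using that
    proof (induction k)
      case (Suc k)
      then have "D k \<noteq> 0" by (intro nz) simp
      from residual_pythagoras[OF step orth[OF this]]
      have "(\<Sum>i\<in>UNIV. (l (Suc k) i)\<^sup>2) \<le> (\<Sum>i\<in>UNIV. (l k i)\<^sup>2)"
        by (simp add: sum_nonneg)
      with Suc show ?case by simp
    qed simp
    have const: "l k i = l k j" if "D k = 0" for k i j
      using gram_det_zero_imp_const[of "l k"] ne1 that unfolding D by simp
    define s where "s = l K i"
    have s: "l K j = s" for j unfolding s_def by (rule const[OF DK])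
    have "real CARD('n) * s\<^sup>2 = (\<Sum>i\<in>UNIV. (l K i)\<^sup>2)"
      by (simp add: s)
    also have "\<dots> < real CARD('n)"
      using dec[of K] init by simp
    finally have "s\<^sup>2 < 1" by simp
    then have "\<bar>s\<bar> < 1"
      by (simp only: abs_square_less_1)
    \<comment> \<open>Equal eigenvalues make the Gram determinant vanish again, so from
      \<open>K\<close> on the default coefficients 0 and 1 apply and each update is a
      squaring.\<close>
    have pow: "l (j + K) i' = s ^ (2 ^ j)" for j i'
    proof (induction j arbitrary: i')
      case (Suc j)
      have "D (j + K) = 0"
        unfolding D Suc by (simp add: power2_eq_square)
      then have "a (j + K) = 0" "b (j + K) = 1"
        unfolding a_def b_def D_def SSHP2_\<alpha>_def SSHP2_\<beta>_def by simp_all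
      then show ?case
        by (simp add: step Suc mult_2 power_add)
    qed (simp add: s)
    have "(\<lambda>j. l (j + K) i) \<longlonglongrightarrow> 0"
    proof (rule Lim_null_comparison)
      show "\<forall>\<^sub>F j in sequentially. norm (l (j + K) i) \<le> \<bar>s\<bar> ^ j"
        using \<open>\<bar>s\<bar> < 1\<close>
        by (intro always_eventually allI) (simp add: pow power_abs power_decreasing less_imp_le)
      show "(\<lambda>j. \<bar>s\<bar> ^ j) \<longlonglongrightarrow> 0"
        using \<open>\<bar>s\<bar> < 1\<close> by (intro LIMSEQ_realpow_zero) auto
    qed
    then show ?thesis by (rule LIMSEQ_offset)
  qed
  \<comment> \<open>The Frobenius norm of \<open>F\<close> is the Euclidean norm of its eigenvalue
    vector, so the limits of the single eigenvalues suffice.\<close>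
  have "(\<lambda>k. sqrt (\<Sum>i\<in>UNIV. (l k i)\<^sup>2)) \<longlonglongrightarrow> sqrt (\<Sum>(i::'n)\<in>UNIV. 0\<^sup>2)"
    by (intro tendsto_intros lim)
  moreover have "norm (SSHP2_F A X0 k) = sqrt (\<Sum>i\<in>UNIV. (l k i)\<^sup>2)" for k
    by (simp only: F norm_conj_diag[OF U, symmetric] real_sqrt_abs abs_norm_cancel)
  ultimately have "(\<lambda>k. norm (SSHP2_F A X0 k)) \<longlonglongrightarrow> 0"
    by (simp only: power_zero_numeral sum.neutral_const real_sqrt_zero)
  then show ?thesis
    unfolding SSHP2_converges_def by (rule tendsto_norm_zero_cancel)
qed

end
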